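(* For positive integers $n$ and $k$, let $M(n,k)$ denote the number of maximal intersecting families $\mathcal{F}\subseteq\binom{[n]}{k}$, i.e. families of $k$-element subsets of $[n]=\{1,\dots,n\}$ such that $F_1\cap F_2\neq\emptyset$ for all $F_1,F_2\in\mathcal{F}$ and no further set of $\binom{[n]}{k}$ can be added to $\mathcal{F}$ while preserving this property. Then for any fixed positive integer $k$, as $n\to\infty$, \[ M(n,k)=n^{\Theta\left(\binom{2k}{k}\right)}. \] Moreover, \[ \frac{1}{8}\le \limsup_{n\to\infty}\frac{\log M(n,k)}{\binom{2k}{k}\log n}\le 1.1 \qquad\text{and}\qquad \limsup_{k\to\infty}\limsup_{n\to\infty}\frac{\log M(n,k)}{\binom{2k}{k}\log n}\le 1. \]
   Context: $\binom{[n]}{k}$ denotes the family of all $k$-element subsets of $[n]=\{1,2,\dots,n\}$. A family of sets is intersecting if any two of its members (not necessarily distinct) have nonempty intersection. *)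

theory Defs
  imports Complex_Main "HOL-Library.Ramsey" "HOL-Library.Extended_Real"
begin

(* A and B may coincide, so an intersecting family does not contain the empty set. *)
definition intersecting :: "'a set set \<Rightarrow> bool" where
  "intersecting F \<longleftrightarrow> (\<forall>A\<in>F. \<forall>B\<in>F. A \<inter> B \<noteq> {})"

definition maximal_intersecting :: "nat \<Rightarrow> nat \<Rightarrow> nat set set \<Rightarrow> bool" where
  "maximal_intersecting n k F \<longleftrightarrow>
     F \<subseteq> nsets {1..n} k \<and> intersecting F \<and>
     (\<forall>A \<in> nsets {1..n} k - F. \<not> intersecting (insert A F))"

definition M :: "nat \<Rightarrow> nat \<Rightarrow> nat" where
  "M n k = card {F. maximal_intersecting n k F}"

(* Extended-real valued, so that the limits superior below exist without
   a prior boundedness argument. *)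
definition log_ratio :: "nat \<Rightarrow> nat \<Rightarrow> ereal" where
  "log_ratio n k = ereal (ln (real (M n k)) / (real ((2 * k) choose k) * ln (real n)))"

end

theory Submission
  imports Defs "HOL-Library.Function_Algebras" "HOL-Computational_Algebra.Polynomial"
begin

text \<open>Upper bound: a maximal intersecting family is determined by its inclusion-minimal transversals
  of size at most \<open>k\<close>, so it suffices that these span at most \<open>(2 * k) choose k\<close> points. They form an
  intersecting family in which every point of every member \<open>A\<close> is the whole of \<open>A \<inter> B\<close> for some
  member \<open>B\<close>. Cover the points greedily by pairs \<open>A\<^sub>i, B\<^sub>i\<close> meeting in one new point, and let \<open>W\<^sub>i\<close> be the
  set of points covered before. Then the pairs \<open>(A\<^sub>i \<inter> W\<^sub>i, B\<^sub>i)\<close> and \<open>(B\<^sub>i \<inter> W\<^sub>i, A\<^sub>i)\<close> form a skew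
  set-pair system, so by the skew Bollobas inequality at most \<open>(2 * k - s) choose (k - s)\<close> of them
  (up to the first stage) come from a set with at least \<open>s\<close> new points. Summing over \<open>s\<close> bounds the
  number of points.\<close>

section \<open>Linear independence by triangular evaluation\<close>

interpretation real_fun: vector_space "\<lambda>(c::real) (f :: 'w \<Rightarrow> real) w. c * f w"
  by unfold_locales (auto simp: fun_eq_iff algebra_simps)

lemma real_fun_subspace_vanishing: "real_fun.subspace {g :: 'w \<Rightarrow> real. g w = 0}"
  by (auto simp: real_fun.subspace_def)

text \<open>Going up through \<open>J\<close>, every earlier function vanishes at
  \<open>w j\<close>, hence so does everything in their span, while \<open>f j\<close> does not. So
  the \<open>f j\<close> are distinct and independent inside the span of \<open>S\<close>.\<close>

lemma card_le_of_triangular_evaluation: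
  fixes f :: "'i::linorder \<Rightarrow> 'w \<Rightarrow> real" and w :: "'i \<Rightarrow> 'w"
  assumes "finite J" "finite S"
    and span: "\<And>j. j \<in> J \<Longrightarrow> f j \<in> real_fun.span S"
    and diag: "\<And>j. j \<in> J \<Longrightarrow> f j (w j) \<noteq> 0"
    and tri: "\<And>i j. i \<in> J \<Longrightarrow> j \<in> J \<Longrightarrow> i < j \<Longrightarrow> f i (w j) = 0"
  shows "card J \<le> card S"
proof -
  have "K \<subseteq> J \<longrightarrow> real_fun.independent (f ` K) \<and> inj_on f K" if "finite K" for K
    using that
  proof (induction K rule: finite_linorder_max_induct)
    case empty
    show ?case by (simp add: real_fun.independent_empty)
  next
    case (insert j K)
    show ?case
    proof
      assume sub: "insert j K \<subseteq> J"
      have "real_fun.span (f ` K) \<subseteq> {g. g (w j) = 0}"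
        using sub insert.hyps tri
        by (intro real_fun.span_minimal real_fun_subspace_vanishing) auto
      with sub diag have notin: "f j \<notin> real_fun.span (f ` K)" by auto
      then have "f j \<notin> f ` K" using real_fun.span_base by blast
      moreover have "K - {j} = K" using insert.hyps by auto
      ultimately show "real_fun.independent (f ` insert j K) \<and> inj_on f (insert j K)"
        using notin sub insert.IH by (simp add: real_fun.independent_insert)
    qed
  qed
  with \<open>finite J\<close> have ind: "real_fun.independent (f ` J)" and inj: "inj_on f J" by auto
  have "card (f ` J) \<le> card S"
    using real_fun.independent_span_bound[OF \<open>finite S\<close> ind] span by auto
  with inj show ?thesis by (simp add: card_image)
qed

section \<open>Polynomials of bounded degree in several variables\<close>

text \<open>The monomials of degree at most \<open>b\<close> in the variables \<open>w 0\<close>,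
  ..., \<open>w (a - 1)\<close>, as functions. The recursion asks whether the last variable divides
  the monomial, so that counting follows Pascal's rule.\<close>

fun monomials :: "nat \<Rightarrow> nat \<Rightarrow> ((nat \<Rightarrow> real) \<Rightarrow> real) set" where
  "monomials 0 b = {\<lambda>_. 1}"
| "monomials (Suc a) 0 = {\<lambda>_. 1}"
| "monomials (Suc a) (Suc b) = monomials a (Suc b) \<union> (\<lambda>g w. w a * g w) ` monomials (Suc a) b"

lemma finite_monomials [simp]: "finite (monomials a b)"
  by (induction a b rule: monomials.induct) auto

lemma card_monomials_le: "card (monomials a b) \<le> (a + b) choose a"
proof (induction a b rule: monomials.induct)
  case (3 a b)
  have "card (monomials (Suc a) (Suc b))
      \<le> card (monomials a (Suc b)) + card ((\<lambda>g w. w a * g w) ` monomials (Suc a) b)"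
    by (simp add: card_Un_le)
  also have "\<dots> \<le> ((a + Suc b) choose a) + ((Suc a + b) choose Suc a)"
    by (intro add_mono 3 order.trans[OF card_image_le 3(2)]) simp
  finally show ?case by simp
qed auto

lemma one_in_monomials [simp]: "(\<lambda>_. 1) \<in> monomials a b"
  by (induction a b rule: monomials.induct) auto

lemma monomials_mono_Suc: "monomials a b \<subseteq> monomials a (Suc b)"
  by (induction a b rule: monomials.induct) auto

lemma times_var_in_monomials:
  "g \<in> monomials a b \<Longrightarrow> l < a \<Longrightarrow> (\<lambda>w. w l * g w) \<in> monomials a (Suc b)"
proof (induction a b arbitrary: g rule: monomials.induct)
  case (2 a)
  have "l < c \<Longrightarrow> (\<lambda>w. w l) \<in> monomials c (Suc 0)" for c
    by (induction c) (auto simp: less_Suc_eq)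
  moreover have "g = (\<lambda>_. 1)" using 2 by simp
  ultimately show ?case using \<open>l < Suc a\<close> by (simp only: mult_1_right)
next
  case (3 a b)
  consider "l = a" | "l < a" "g \<in> monomials a (Suc b)"
    | h where "l < a" "h \<in> monomials (Suc a) b" "g = (\<lambda>w. w a * h w)"
    using "3.prems" by (auto simp only: less_Suc_eq monomials.simps Un_iff image_iff)
  then show ?case
  proof cases
    case 1
    with "3.prems" show ?thesis
      by (simp only: monomials.simps(3)[of _ "Suc b"]) (intro UnI2 imageI)
  next
    case 2
    from "3.IH"(1)[OF 2(2,1)] show ?thesis
      by (simp only: monomials.simps(3)[of _ "Suc b"]) (intro UnI1)
  next
    \<comment> \<open>The factor \<open>w l\<close> moves past \<open>w a\<close> onto
      \<open>h\<close>, where the induction hypothesis with the smaller degree bound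
      applies.\<close>
    case (3 h)
    with "3.IH"(2) have "(\<lambda>w. w l * h w) \<in> monomials (Suc a) (Suc b)" by simp
    then have "(\<lambda>w. w a * (w l * h w)) \<in> monomials (Suc a) (Suc (Suc b))"
      by (simp only: monomials.simps(3)[of _ "Suc b"]) (intro UnI2 imageI)
    moreover have "(\<lambda>w. w l * g w) = (\<lambda>w. w a * (w l * h w))"
      using 3 by (simp add: mult.left_commute)
    ultimately show ?thesis by (simp only:)
  qed
qed auto

text \<open>The functions whose product with \<open>w l\<close> lies in the larger span form a
  subspace, and this subspace contains the monomials.\<close>

lemma times_var_in_span_monomials:
  assumes "g \<in> real_fun.span (monomials a b)" and "l < a"
  shows "(\<lambda>w. w l * g w) \<in> real_fun.span (monomials a (Suc b))"
proof -
  have "real_fun.subspace {g. (\<lambda>w. w l * g w) \<in> real_fun.span (monomials a (Suc b))}"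
  proof (rule real_fun.subspaceI)
    show "0 \<in> {g. (\<lambda>w. w l * g w) \<in> real_fun.span (monomials a (Suc b))}"
      using real_fun.span_zero[of "monomials a (Suc b)"] by (simp add: zero_fun_def)
  next
    fix g h assume "g \<in> {g. (\<lambda>w. w l * g w) \<in> real_fun.span (monomials a (Suc b))}"
      "h \<in> {g. (\<lambda>w. w l * g w) \<in> real_fun.span (monomials a (Suc b))}"
    then have "(\<lambda>w. w l * g w) + (\<lambda>w. w l * h w) \<in> real_fun.span (monomials a (Suc b))"
      by (simp add: real_fun.span_add)
    then show "g + h \<in> {g. (\<lambda>w. w l * g w) \<in> real_fun.span (monomials a (Suc b))}"
      by (simp add: plus_fun_def distrib_left)
  next
    fix c :: real and g :: "(nat \<Rightarrow> real) \<Rightarrow> real"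
    assume "g \<in> {g. (\<lambda>w. w l * g w) \<in> real_fun.span (monomials a (Suc b))}"
    then have "(\<lambda>w. c * (w l * g w)) \<in> real_fun.span (monomials a (Suc b))"
      using real_fun.span_scale by blast
    then show "(\<lambda>w. c * g w) \<in> {g. (\<lambda>w. w l * g w) \<in> real_fun.span (monomials a (Suc b))}"
      by (simp add: mult.left_commute)
  qed
  moreover have "monomials a b \<subseteq> {g. (\<lambda>w. w l * g w) \<in> real_fun.span (monomials a (Suc b))}"
    using times_var_in_monomials[OF _ \<open>l < a\<close>] real_fun.span_base by blast
  ultimately show ?thesis using real_fun.span_minimal assms(1) by blast
qed

lemma times_affine_in_span_monomials:
  assumes "g \<in> real_fun.span (monomials a b)"
  shows "(\<lambda>w. (c + (\<Sum>l<a. w l * d l)) * g w) \<in> real_fun.span (monomials a (Suc b))"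
proof -
  have "(\<lambda>w. c * g w) \<in> real_fun.span (monomials a (Suc b))"
    using real_fun.span_scale assms real_fun.span_mono[OF monomials_mono_Suc] by blast
  moreover have "(\<Sum>l<a. (\<lambda>w. d l * (w l * g w))) \<in> real_fun.span (monomials a (Suc b))"
    by (intro real_fun.span_sum real_fun.span_scale times_var_in_span_monomials assms) auto
  ultimately have "(\<lambda>w. c * g w) + (\<Sum>l<a. (\<lambda>w. d l * (w l * g w))) \<in> real_fun.span (monomials a (Suc b))"
    by (rule real_fun.span_add)
  moreover have "(\<Sum>l\<in>L. (\<lambda>w. d l * (w l * g w))) = (\<lambda>w. (\<Sum>l\<in>L. w l * d l) * g w)"
    if "finite L" for L :: "nat set"
    using that by (induction L) (auto simp: fun_eq_iff algebra_simps)
  ultimately show ?thesis by (simp add: plus_fun_def distrib_right)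
qed

text \<open>Each affine factor raises the degree by at most one. With powers of a point as the
  \<open>d v l\<close>, such a product is a resultant in terms of polynomial coefficients.\<close>

lemma prod_affine_in_span_monomials:
  assumes "finite B" "card B \<le> b"
  shows "(\<lambda>w. \<Prod>v\<in>B. c v + (\<Sum>l<a. w l * d v l)) \<in> real_fun.span (monomials a b)"
proof -
  have "(\<lambda>w. \<Prod>v\<in>B. c v + (\<Sum>l<a. w l * d v l)) \<in> real_fun.span (monomials a (card B))"
    using assms(1)
  proof induction
    case empty
    show ?case by (simp add: real_fun.span_base)
  next
    case (insert v B)
    then show ?case using times_affine_in_span_monomials by simp
  qed
  moreover have "monomials a (card B) \<subseteq> monomials a b"
    using lift_Suc_mono_le[of "monomials a", OF monomials_mono_Suc assms(2)] .
  ultimately show ?thesis using real_fun.span_mono by blast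
qed

section \<open>The skew Bollobas inequality\<close>

text \<open>Each first set becomes a monic polynomial of degree \<open>a\<close> with roots in that set, padded by the
  spare root \<open>-1\<close>. Each second set becomes the map sending a polynomial to the product of its values
  on that set, so that the pairing is a resultant.\<close>

lemma skew_bollobas:
  fixes A B :: "'i::linorder \<Rightarrow> 'a set"
  assumes "finite J"
    and fin: "\<And>i. i \<in> J \<Longrightarrow> finite (A i) \<and> finite (B i)"
    and cardA: "\<And>i. i \<in> J \<Longrightarrow> card (A i) \<le> a"
    and cardB: "\<And>i. i \<in> J \<Longrightarrow> card (B i) \<le> b"
    and disj: "\<And>i. i \<in> J \<Longrightarrow> A i \<inter> B i = {}"
    and skew: "\<And>i j. i \<in> J \<Longrightarrow> j \<in> J \<Longrightarrow> i < j \<Longrightarrow> A j \<inter> B i \<noteq> {}"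
  shows "card J \<le> (a + b) choose a"
proof -
  define U where "U = (\<Union>i\<in>J. A i \<union> B i)"
  have "finite U" using \<open>finite J\<close> fin by (simp add: U_def)
  \<comment> \<open>Labels are natural numbers, so the spare root \<open>-1\<close> is never a
    label.\<close>
  then obtain h :: "'a \<Rightarrow> nat" where h: "inj_on h U"
    using finite_imp_inj_to_nat_seg[OF \<open>finite U\<close>] by blast
  define p where "p i = (\<Prod>u\<in>A i. [:- real (h u), 1:]) * [:1, 1:] ^ (a - card (A i))" for i
  \<comment> \<open>A monic polynomial of degree \<open>a\<close> is given by its \<open>a\<close>
    lower coefficients \<open>w\<close>. Fixing the leading coefficient makes each factor affine in
    only \<open>a\<close> variables, which yields the sharp binomial.\<close>
  define f where "f j w = (\<Prod>v\<in>B j. real (h v) ^ a + (\<Sum>l<a. w l * real (h v) ^ l))"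
    for j and w :: "nat \<Rightarrow> real"
  have deg: "degree (p i) = a" and monic: "coeff (p i) a = 1" if "i \<in> J" for i
  proof -
    have d: "degree (\<Prod>u\<in>A i. [:- real (h u), 1:]) = card (A i)"
      by (subst degree_prod_eq_sum_degree) auto
    have d': "degree (p i) = card (A i) + degree ([:1, 1::real:] ^ (a - card (A i)))"
      unfolding p_def using d by (subst degree_mult_eq) (auto simp: fin[OF that])
    then show "degree (p i) = a" using cardA[OF that] by (simp add: degree_power_eq)
    moreover have "lead_coeff (p i) = 1"
      by (simp add: p_def lead_coeff_mult lead_coeff_prod lead_coeff_power)
    ultimately show "coeff (p i) a = 1" by simp
  qed
  have "f j (coeff (p i)) = (\<Prod>v\<in>B j. poly (p i) (real (h v)))" if "i \<in> J" for i j
    unfolding f_def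
    by (intro prod.cong refl)
      (simp add: poly_altdef deg[OF that] monic[OF that] lessThan_Suc_atMost[symmetric])
  moreover have "poly (p i) (real (h v)) = 0 \<longleftrightarrow> v \<in> A i" if "i \<in> J" "j \<in> J" "v \<in> B j" for i j v
  proof -
    have "v \<in> U" "A i \<subseteq> U" using that by (auto simp: U_def)
    have "poly (p i) (real (h v)) = 0 \<longleftrightarrow> (\<exists>u\<in>A i. h v = h u)"
      using fin[OF that(1)] by (auto simp: p_def poly_prod add_eq_0_iff)
    also have "\<dots> \<longleftrightarrow> v \<in> A i"
      using inj_onD[OF h] \<open>v \<in> U\<close> \<open>A i \<subseteq> U\<close> by blast
    finally show ?thesis .
  qed
  ultimately have f_zero: "f j (coeff (p i)) = 0 \<longleftrightarrow> A i \<inter> B j \<noteq> {}" if "i \<in> J" "j \<in> J" for i j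
    using that fin[OF that(2)] by auto
  have "card J \<le> card (monomials a b)"
  proof (rule card_le_of_triangular_evaluation[where f = f and w = "\<lambda>i. coeff (p i)"])
    show "f j \<in> real_fun.span (monomials a b)" if "j \<in> J" for j
      unfolding f_def using fin cardB that by (intro prod_affine_in_span_monomials) auto
  qed (use \<open>finite J\<close> f_zero disj skew in auto)
  then show ?thesis using card_monomials_le le_trans by blast
qed

section \<open>The number of points of an intersecting crossing family\<close>

definition crossing :: "'a set set \<Rightarrow> bool" where
  "crossing \<T> \<longleftrightarrow> (\<forall>T\<in>\<T>. \<forall>x\<in>T. \<exists>T'\<in>\<T>. T \<inter> T' = {x})"

text \<open>Take a longest sequence of pairs, each meeting in one point not covered before. These
  points are distinct, which bounds the length; an uncovered point would be the meeting point of a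
  further pair.\<close>

lemma crossing_greedy_cover:
  fixes \<T> :: "'a set set"
  assumes "finite (\<Union>\<T>)" "crossing \<T>"
  obtains m and A B :: "nat \<Rightarrow> 'a set"
  where "\<forall>i<m. A i \<in> \<T> \<and> B i \<in> \<T>"
    and "\<forall>i<m. A i \<inter> B i \<inter> (\<Union>j<i. A j \<union> B j) = {}"
    and "\<Union>\<T> = (\<Union>j<m. A j \<union> B j)"
proof -
  define P where "P m \<longleftrightarrow> (\<exists>A B :: nat \<Rightarrow> 'a set. (\<forall>i<m. A i \<in> \<T> \<and> B i \<in> \<T> \<and>
      (\<exists>x. A i \<inter> B i = {x} \<and> x \<notin> (\<Union>j<i. A j \<union> B j))))" for m
  have bound: "m \<le> card (\<Union>\<T>)" if "P m" for m
  proof -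
    from that obtain A B x where AB: "\<And>i. i < m \<Longrightarrow> A i \<in> \<T> \<and> B i \<in> \<T>"
      and x: "\<And>i. i < m \<Longrightarrow> A i \<inter> B i = {x i} \<and> x i \<notin> (\<Union>j<i. A j \<union> B j)"
      unfolding P_def by metis
    have "x i \<noteq> x j" if "i < j" "j < m" for i j
      using x[of i] x[of j] that by auto
    then have "inj_on x {..<m}"
      by (metis inj_onI lessThan_iff linorder_neqE_nat)
    moreover have "x ` {..<m} \<subseteq> \<Union>\<T>" using AB x by blast
    ultimately show ?thesis
      using card_inj_on_le[of x "{..<m}" "\<Union>\<T>"] assms(1) by simp
  qed
  define m where "m = (GREATEST m. P m)"
  have "P 0" by (simp add: P_def)
  then have "P m" unfolding m_def using bound by (rule GreatestI_nat)
  then obtain A B where AB: "\<And>i. i < m \<Longrightarrow> A i \<in> \<T> \<and> B i \<in> \<T>"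
    and cross: "\<And>i. i < m \<Longrightarrow> \<exists>x. A i \<inter> B i = {x} \<and> x \<notin> (\<Union>j<i. A j \<union> B j)"
    unfolding P_def by blast
  have "\<Union>\<T> \<subseteq> (\<Union>j<m. A j \<union> B j)"
  proof
    fix x assume "x \<in> \<Union>\<T>"
    show "x \<in> (\<Union>j<m. A j \<union> B j)"
    proof (rule ccontr)
      assume new: "x \<notin> (\<Union>j<m. A j \<union> B j)"
      from \<open>x \<in> \<Union>\<T>\<close> obtain T T' where T: "T \<in> \<T>" "T' \<in> \<T>" "T \<inter> T' = {x}"
        using assms(2) unfolding crossing_def by blast
      let ?A = "A(m := T)" and ?B = "B(m := T')"
      have "(\<Union>j<i. ?A j \<union> ?B j) = (\<Union>j<i. A j \<union> B j)" if "i \<le> m" for i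
        using that by (intro SUP_cong) auto
      with AB cross T new
      have "\<forall>i<Suc m. ?A i \<in> \<T> \<and> ?B i \<in> \<T> \<and> (\<exists>x. ?A i \<inter> ?B i = {x} \<and> x \<notin> (\<Union>j<i. ?A j \<union> ?B j))"
        by (auto simp: less_Suc_eq)
      then have "P (Suc m)" unfolding P_def by blast
      then have "Suc m \<le> m" unfolding m_def using bound by (rule Greatest_le_nat)
      then show False by simp
    qed
  qed
  moreover have "(\<Union>j<m. A j \<union> B j) \<subseteq> \<Union>\<T>" using AB by blast
  ultimately have "\<Union>\<T> = (\<Union>j<m. A j \<union> B j)" by simp
  moreover have "A i \<inter> B i \<inter> (\<Union>j<i. A j \<union> B j) = {}" if i: "i < m" for i
  proof -
    obtain x where x: "A i \<inter> B i = {x}" "x \<notin> (\<Union>j<i. A j \<union> B j)"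
      using cross[OF i] by blast
    from x(2) have "{x} \<inter> (\<Union>j<i. A j \<union> B j) = {}" by blast
    then show ?thesis by (simp only: x(1))
  qed
  ultimately show ?thesis using AB by (intro that) auto
qed

text \<open>Layer-cake summation: \<open>f i\<close> counts the thresholds \<open>s\<close> from
  \<open>1\<close> to \<open>f i\<close>, and the two sums are exchanged.\<close>

lemma sum_eq_sum_card_ge:
  fixes f :: "'i \<Rightarrow> nat"
  assumes "finite I" "\<And>i. i \<in> I \<Longrightarrow> f i \<le> k"
  shows "(\<Sum>i\<in>I. f i) = (\<Sum>s=1..k. card {i\<in>I. s \<le> f i})"
proof -
  have "f i = (\<Sum>s=1..k. if s \<le> f i then 1 else 0)" if "i \<in> I" for i
  proof -
    have "{1..k} \<inter> {s. s \<le> f i} = {1..f i}" using assms(2)[OF that] by auto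
    then show ?thesis by (simp add: sum.If_cases)
  qed
  then have "(\<Sum>i\<in>I. f i) = (\<Sum>i\<in>I. \<Sum>s=1..k. if s \<le> f i then 1 else 0)"
    by (intro sum.cong) auto
  also have "\<dots> = (\<Sum>s=1..k. \<Sum>i\<in>I. if s \<le> f i then 1 else 0)" by (rule sum.swap)
  also have "\<dots> = (\<Sum>s=1..k. card {i\<in>I. s \<le> f i})"
    using assms(1) by (simp add: sum.If_cases Int_def)
  finally show ?thesis .
qed

lemma square_le_choose: "(Suc j)\<^sup>2 \<le> (2 * Suc j) choose j"
proof (induction j)
  case (Suc j)
  show ?case
  proof (cases "j = 0")
    \<comment> \<open>Pascal's rule yields a factor of \<open>3\<close>, which beats the growth of
      the squares only from \<open>j = 1\<close> on; for \<open>j = 0\<close> both sides equal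
      \<open>4\<close>.\<close>
    case False
    have "(2 * Suc j) choose j \<le> Suc (2 * Suc j) choose j"
      by (cases j) auto
    moreover have "(2 * Suc j) choose j \<le> (2 * Suc j) choose Suc j"
      by (rule binomial_mono) auto
    ultimately have "3 * ((2 * Suc j) choose j) \<le> Suc (Suc (2 * Suc j)) choose Suc j"
      by simp
    moreover have "(Suc (Suc j))\<^sup>2 \<le> 3 * (Suc j)\<^sup>2"
      using False by (cases j) (auto simp: power2_eq_square)
    ultimately show ?thesis using Suc.IH by simp
  qed (simp add: power2_eq_square)
qed simp

text \<open>By absorption, \<open>k\<close> times the gap between the two binomials equals the
  smaller one, which is at least the square of \<open>k\<close>. The gap pays for the one index left
  out of the set-pair system below.\<close>

lemma choose_pred_add_le_central:
  assumes "0 < k"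
  shows "k + ((2 * k) choose (k - 1)) \<le> (2 * k) choose k"
proof -
  obtain j where k: "k = Suc j" using assms gr0_implies_Suc by blast
  have "k * ((2 * k) choose k) = (2 * k - j) * ((2 * k) choose j)"
    using binomial_absorption[of j "2 * k"] binomial_absorb_comp[of "2 * k" j] by (simp add: k)
  also have "\<dots> = k * ((2 * k) choose j) + ((2 * k) choose j)"
    by (simp add: k algebra_simps)
  also have "\<dots> \<ge> k * (k + ((2 * k) choose j))"
    using square_le_choose[of j] by (simp add: k power2_eq_square add_mult_distrib2)
  finally have "k + ((2 * k) choose j) \<le> (2 * k) choose k"
    using assms by (simp only: nat_mult_le_cancel1)
  then show ?thesis by (simp only: k diff_Suc_1)
qed

lemma card_Union_crossing_le:
  fixes \<T> :: "'a set set"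
  assumes "finite (\<Union>\<T>)" "crossing \<T>" "intersecting \<T>"
    and card: "\<And>T. T \<in> \<T> \<Longrightarrow> card T \<le> k"
  shows "card (\<Union>\<T>) \<le> (2 * k) choose k"
proof (cases "k = 0 \<or> \<T> = {}")
  case True
  have "T = {}" if "k = 0" "T \<in> \<T>" for T
  proof -
    have "finite T" using that assms(1) by (meson Sup_upper finite_subset)
    with card[OF that(2)] \<open>k = 0\<close> show ?thesis by simp
  qed
  with True have "\<Union>\<T> = {}" by blast
  then show ?thesis by (simp only: card.empty)
next
  case False
  then have "k \<noteq> 0" by simp
  obtain m and A B :: "nat \<Rightarrow> 'a set"
    where AB: "\<forall>i<m. A i \<in> \<T> \<and> B i \<in> \<T>"
    and disj: "\<forall>i<m. A i \<inter> B i \<inter> (\<Union>j<i. A j \<union> B j) = {}"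
    and cover: "\<Union>\<T> = (\<Union>j<m. A j \<union> B j)"
    by (rule crossing_greedy_cover[OF assms(1,2)])
  define W where "W i = (\<Union>j<i. A j \<union> B j)" for i
  have fin: "finite T" if "T \<in> \<T>" for T
    using that assms(1) by (meson Sup_upper finite_subset)
  have meet: "S \<inter> T \<noteq> {}" if "S \<in> \<T>" "T \<in> \<T>" for S T
    using assms(3) that by (auto simp: intersecting_def)
  \<comment> \<open>Index \<open>2 * i\<close> stands for \<open>(B i, A i)\<close> and \<open>2 * i + 1\<close> for \<open>(A i, B i)\<close>.\<close>
  define fst_set where "fst_set l = (if even l then B (l div 2) else A (l div 2))" for l
  define snd_set where "snd_set l = (if even l then A (l div 2) else B (l div 2))" for l
  define new where "new l = card (fst_set l - W (l div 2))" for l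
  have mem: "fst_set l \<in> \<T>" "snd_set l \<in> \<T>" if "l < 2 * m" for l
  proof -
    have "l div 2 < m" using that by auto
    then show "fst_set l \<in> \<T>" "snd_set l \<in> \<T>" using AB by (auto simp: fst_set_def snd_set_def)
  qed
  have new_le: "new l \<le> k" if "l < 2 * m" for l
    unfolding new_def
    by (rule order.trans[OF card_mono card[OF mem(1)[OF that]]]) (use fin mem that in auto)
  \<comment> \<open>Index \<open>0\<close> is left out: \<open>W 0\<close> is empty, so the first
    set of index \<open>1\<close> could not meet anything inside it. As the least index,
    \<open>1\<close> has no earlier set to meet.\<close>
  have level: "card {l\<in>{1..<2 * m}. s \<le> new l} \<le> (2 * k - s) choose (k - s)"
    if s: "s \<in> {1..k}" for s
  proof -
    let ?J = "{l\<in>{1..<2 * m}. s \<le> new l}"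
    have "card ?J \<le> (k - s + k) choose (k - s)"
    proof (rule skew_bollobas[where A = "\<lambda>l. fst_set l \<inter> W (l div 2)" and B = snd_set])
      fix l assume l: "l \<in> ?J"
      then have mem_l: "fst_set l \<in> \<T>" "snd_set l \<in> \<T>" using mem by auto
      then show "finite (fst_set l \<inter> W (l div 2)) \<and> finite (snd_set l)" using fin by blast
      show "card (snd_set l) \<le> k" using mem_l card by blast
      have "card (fst_set l \<inter> W (l div 2)) + new l = card (fst_set l)"
        using card_Int_Diff[OF fin[OF mem_l(1)], of "W (l div 2)"] by (simp add: new_def)
      with l card[OF mem_l(1)] show "card (fst_set l \<inter> W (l div 2)) \<le> k - s" by auto
      have "l div 2 < m" using l by auto
      with disj show "fst_set l \<inter> W (l div 2) \<inter> snd_set l = {}"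
        by (auto simp: fst_set_def snd_set_def W_def)
    next
      fix i j assume ij: "i \<in> ?J" "j \<in> ?J" "i < j"
      \<comment> \<open>Either \<open>i\<close> belongs to an earlier stage, so its second set is
        already covered, or \<open>i\<close> and \<open>j\<close> are the two orders of one
        pair.\<close>
      have "snd_set i \<subseteq> W (j div 2) \<or> (snd_set i = fst_set j)"
      proof (cases "i div 2 < j div 2")
        case True
        then show ?thesis unfolding snd_set_def W_def by auto
      next
        case False
        with ij(3) have "i div 2 = j div 2" "even i" "odd j" by presburger+
        then show ?thesis by (auto simp: snd_set_def fst_set_def)
      qed
      then show "fst_set j \<inter> W (j div 2) \<inter> snd_set i \<noteq> {}"
      proof
        assume "snd_set i \<subseteq> W (j div 2)"
        moreover have "fst_set j \<inter> snd_set i \<noteq> {}" using ij mem by (intro meet) auto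
        ultimately show ?thesis by blast
      next
        assume eq: "snd_set i = fst_set j"
        \<comment> \<open>As \<open>i\<close> is not \<open>0\<close>, the common stage is not the
          first one. So \<open>A 0\<close> is already covered, and \<open>fst_set j\<close> meets
          it.\<close>
        have "0 < j div 2" using ij by auto
        then have "A 0 \<subseteq> W (j div 2)" by (auto simp: W_def)
        moreover have "fst_set j \<inter> A 0 \<noteq> {}" using ij mem AB by (intro meet) auto
        ultimately show ?thesis using eq by blast
      qed
    qed simp
    with s show ?thesis by (simp add: add.commute mult_2)
  qed
  have "card (W n) \<le> (\<Sum>l<2 * n. new l)" if "n \<le> m" for n
    using that
  proof (induction n)
    case (Suc n)
    have "W (Suc n) = W n \<union> ((A n - W n) \<union> (B n - W n))"
      by (auto simp: W_def lessThan_Suc)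
    then have "card (W (Suc n)) \<le> card (W n) + (card (A n - W n) + card (B n - W n))"
      by (metis card_Un_le add_left_mono order.trans)
    then show ?case using Suc by (simp add: new_def fst_set_def)
  qed (simp add: W_def)
  then have "card (\<Union>\<T>) \<le> (\<Sum>l<2 * m. new l)" by (simp add: cover W_def)
  also have "\<dots> \<le> k + (\<Sum>l=1..<2 * m. new l)"
  proof (cases "m = 0")
    case False
    then show ?thesis
      using new_le[of 0] by (simp add: lessThan_atLeast0 sum.atLeast_Suc_lessThan)
  qed simp
  also have "(\<Sum>l=1..<2 * m. new l) = (\<Sum>s=1..k. card {l\<in>{1..<2 * m}. s \<le> new l})"
    using new_le by (intro sum_eq_sum_card_ge) auto
  also have "\<dots> \<le> (\<Sum>s=1..k. (2 * k - s) choose (k - s))"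
    using level by (rule sum_mono)
  \<comment> \<open>With \<open>r = k - s\<close> the sum runs along a diagonal of Pascal's
    triangle, and the hockey-stick identity evaluates it.\<close>
  also have "\<dots> = (\<Sum>r\<le>k - 1. (k + r) choose r)"
    by (rule sum.reindex_bij_witness[of _ "\<lambda>r. k - r" "\<lambda>s. k - s"])
      (use \<open>k \<noteq> 0\<close> in \<open>auto simp: mult_2\<close>)
  also have "\<dots> = (2 * k) choose (k - 1)"
    using \<open>k \<noteq> 0\<close> by (simp add: sum_choose_lower mult_2)
  also have "k + \<dots> \<le> (2 * k) choose k"
    using \<open>k \<noteq> 0\<close> by (intro choose_pred_add_le_central) simp
  finally show ?thesis by simp
qed

section \<open>Minimal transversals of a maximal intersecting family\<close>

text \<open>On a finite ground set these are the inclusion-minimal transversals of size at most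
  \<open>k\<close>. Minimality is expressed by a witness \<open>G\<close> for each point, the form
  from which \<open>crossing\<close> is derived.\<close>

definition kernels :: "nat \<Rightarrow> 'a set set \<Rightarrow> 'a set set" where
  "kernels k F = {T. card T \<le> k \<and> (\<forall>G\<in>F. T \<inter> G \<noteq> {}) \<and> (\<forall>x\<in>T. \<exists>G\<in>F. T \<inter> G = {x})}"

lemma transversal_contains_kernel:
  assumes "finite T" "card T \<le> k" "\<And>G. G \<in> F \<Longrightarrow> T \<inter> G \<noteq> {}"
  shows "\<exists>K\<in>kernels k F. K \<subseteq> T"
  using assms
proof (induction T rule: finite_psubset_induct)
  case (psubset T)
  show ?case
  proof (cases "\<forall>x\<in>T. \<exists>G\<in>F. T \<inter> G = {x}")
    case True
    with psubset show ?thesis by (auto simp: kernels_def)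
  next
    case False
    then obtain x where x: "x \<in> T" "\<And>G. G \<in> F \<Longrightarrow> T \<inter> G \<noteq> {x}" by blast
    have "(T - {x}) \<inter> G \<noteq> {}" if "G \<in> F" for G
      using x(2)[OF that] psubset.prems(2)[OF that] by blast
    moreover have "card (T - {x}) \<le> k"
      using psubset.prems(1) card_Diff1_le[of T x] by simp
    ultimately have "\<exists>K\<in>kernels k F. K \<subseteq> T - {x}"
      using x(1) by (intro psubset.IH) auto
    then show ?thesis by blast
  qed
qed

lemma kernels_subset_Pow: "kernels k F \<subseteq> Pow (\<Union>F)"
  by (fastforce simp: kernels_def)

text \<open>Members of \<open>F\<close> are themselves transversals of size \<open>k\<close>.
  Conversely, a \<open>k\<close>-set containing a transversal meets all of \<open>F\<close>, and
  maximality puts it into \<open>F\<close>.\<close>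

lemma maximal_intersecting_eq_kernels:
  assumes F: "maximal_intersecting n k F" and "0 < k"
  shows "F = {G \<in> nsets {1..n} k. \<exists>T\<in>kernels k F. T \<subseteq> G}"
proof (intro equalityI subsetI)
  fix G assume "G \<in> F"
  with F have "G \<in> nsets {1..n} k" and "\<And>G'. G' \<in> F \<Longrightarrow> G \<inter> G' \<noteq> {}"
    by (auto simp: maximal_intersecting_def intersecting_def)
  then show "G \<in> {G \<in> nsets {1..n} k. \<exists>T\<in>kernels k F. T \<subseteq> G}"
    using transversal_contains_kernel[of G k F] by (auto simp: nsets_def)
next
  fix G assume "G \<in> {G \<in> nsets {1..n} k. \<exists>T\<in>kernels k F. T \<subseteq> G}"
  then obtain T where G: "G \<in> nsets {1..n} k" and T: "T \<in> kernels k F" "T \<subseteq> G" by blast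
  have meet: "G \<inter> G' \<noteq> {}" if "G' \<in> F" for G'
  proof -
    have "T \<inter> G' \<noteq> {}" using T(1) that by (simp add: kernels_def)
    with T(2) show ?thesis by blast
  qed
  \<comment> \<open>\<open>G\<close> must also meet itself.\<close>
  have "G \<noteq> {}" using G \<open>0 < k\<close> by (auto simp: nsets_def)
  with meet F have "intersecting (insert G F)"
    by (auto simp: maximal_intersecting_def intersecting_def Int_commute)
  with G F show "G \<in> F" by (auto simp: maximal_intersecting_def)
qed

text \<open>If kernels \<open>S\<close> and \<open>T\<close> were disjoint, \<open>S\<close> could
  be enlarged to a \<open>k\<close>-set avoiding \<open>T\<close>, as there are at least
  \<open>2 * k\<close> points; it would lie in \<open>F\<close> and miss \<open>T\<close>. For
  crossing, replace a witness by a kernel inside it, which still meets \<open>T\<close>.\<close>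

lemma
  assumes F: "maximal_intersecting n k F" and "0 < k" "2 * k \<le> n"
  shows intersecting_kernels: "intersecting (kernels k F)"
    and crossing_kernels: "crossing (kernels k F)"
proof -
  note F_eq = maximal_intersecting_eq_kernels[OF F \<open>0 < k\<close>]
  have sub: "T \<subseteq> {1..n}" if "T \<in> kernels k F" for T
    using that kernels_subset_Pow F by (fastforce simp: maximal_intersecting_def nsets_def)
  have meet: "S \<inter> T \<noteq> {}" if ST: "S \<in> kernels k F" "T \<in> kernels k F" for S T
  proof
    assume disj: "S \<inter> T = {}"
    have fin: "finite S" "finite T" using sub ST finite_subset by blast+
    have cards: "card S \<le> k" "card T \<le> k" using ST by (auto simp: kernels_def)
    have "card ({1..n} - (S \<union> T)) = n - card (S \<union> T)"
      using sub ST fin by (subst card_Diff_subset) auto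
    then have "k - card S \<le> card ({1..n} - (S \<union> T))"
      using card_Un_le[of S T] cards \<open>2 * k \<le> n\<close> by linarith
    then obtain R where R: "R \<subseteq> {1..n} - (S \<union> T)" "card R = k - card S" "finite R"
      by (rule obtain_subset_with_card_n)
    have "card (S \<union> R) = k"
      using R fin cards by (subst card_Un_disjoint) auto
    then have "S \<union> R \<in> F"
      using R ST sub fin by (subst F_eq) (auto simp: nsets_def)
    moreover have "T \<inter> (S \<union> R) = {}" using R disj by blast
    ultimately show False using ST(2) by (auto simp: kernels_def)
  qed
  then show "intersecting (kernels k F)" by (auto simp: intersecting_def)
  show "crossing (kernels k F)"
    unfolding crossing_def
  proof (intro ballI)
    fix T x assume T: "T \<in> kernels k F" "x \<in> T"
    then obtain G where G: "G \<in> F" "T \<inter> G = {x}" by (auto simp: kernels_def)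
    from G(1) obtain K where K: "K \<in> kernels k F" "K \<subseteq> G" by (subst (asm) F_eq) blast
    have "T \<inter> K \<subseteq> {x}" using G(2) K(2) by blast
    with meet[OF T(1) K(1)] have "T \<inter> K = {x}" by (simp add: subset_singleton_iff)
    with K show "\<exists>T'\<in>kernels k F. T \<inter> T' = {x}" by blast
  qed
qed

section \<open>Counting from above\<close>

text \<open>A family is encoded by a labelling \<open>g\<close> of the points of its kernels with
  \<open>D\<close> labels, and by the system \<open>P\<close> of label sets that name kernels. The
  two factors count the choices of \<open>g\<close> and \<open>P\<close>.\<close>

lemma M_upper:
  assumes "0 < k" "2 * k \<le> n"
  defines "D \<equiv> (2 * k) choose k"
  shows "M n k \<le> n ^ D * 2 ^ 2 ^ D"
proof -
  define \<Phi> where "\<Phi> = (\<lambda>(g, P :: nat set set). {G \<in> nsets {1..n} k. \<exists>X\<in>P. g ` X \<subseteq> G})"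
  define \<A> where "\<A> = ({..<D} \<rightarrow>\<^sub>E {1..n}) \<times> Pow (Pow {..<D})"
  have "{F. maximal_intersecting n k F} \<subseteq> \<Phi> ` \<A>"
  proof
    fix F assume "F \<in> {F. maximal_intersecting n k F}"
    then have F: "maximal_intersecting n k F" by simp
    define V where "V = \<Union>(kernels k F)"
    have V: "V \<subseteq> {1..n}"
      using kernels_subset_Pow F unfolding V_def
      by (fastforce simp: maximal_intersecting_def nsets_def)
    then have "finite V" using finite_subset by blast
    have "card V \<le> D"
      unfolding V_def D_def using intersecting_kernels[OF F assms(1,2)] crossing_kernels[OF F assms(1,2)]
      by (intro card_Union_crossing_le) (use \<open>finite V\<close> in \<open>auto simp: V_def kernels_def\<close>)
    obtain h where h: "bij_betw h {0..<card V} V"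
      using ex_bij_betw_nat_finite[OF \<open>finite V\<close>] by blast
    \<comment> \<open>Surplus labels go to the dummy value \<open>1\<close>. This is harmless, since
      \<open>P\<close> is defined through images under \<open>g\<close>.\<close>
    define g where "g = (\<lambda>i\<in>{..<D}. if i < card V then h i else 1)"
    have g: "g \<in> {..<D} \<rightarrow>\<^sub>E {1..n}"
      using bij_betwE[OF h] V assms(1,2) unfolding g_def by (auto 0 3)
    define P where "P = {X. X \<subseteq> {..<D} \<and> g ` X \<in> kernels k F}"
    have covered: "V \<subseteq> g ` {..<D}"
    proof
      fix v assume "v \<in> V"
      then have "v \<in> h ` {0..<card V}" using h by (simp add: bij_betw_def)
      then obtain i where "i < card V" "h i = v" by auto
      with \<open>card V \<le> D\<close> have "i < D" "g i = v" by (auto simp: g_def)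
      then show "v \<in> g ` {..<D}" by blast
    qed
    have "kernels k F = image g ` P"
    proof (intro equalityI subsetI)
      fix T assume T: "T \<in> kernels k F"
      then have "T \<subseteq> g ` {..<D}" using covered by (auto simp: V_def)
      then obtain X where "X \<subseteq> {..<D}" "T = g ` X" by (meson subset_imageE)
      with T show "T \<in> image g ` P" by (auto simp: P_def)
    qed (auto simp: P_def)
    then have "F = \<Phi> (g, P)"
      using maximal_intersecting_eq_kernels[OF F assms(1)] by (simp add: \<Phi>_def)
    moreover have "(g, P) \<in> \<A>" using g by (auto simp: \<A>_def P_def)
    ultimately show "F \<in> \<Phi> ` \<A>" by blast
  qed
  moreover have "finite \<A>" by (simp add: \<A>_def finite_PiE)
  ultimately have "M n k \<le> card \<A>"
    unfolding M_def by (meson card_image_le card_mono finite_imageI order.trans)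
  also have "card \<A> = n ^ D * 2 ^ 2 ^ D"
    by (simp add: \<A>_def card_cartesian_product card_PiE card_Pow)
  finally show ?thesis .
qed

section \<open>Extension to maximal families and counting from below\<close>

lemma finite_maximal_intersecting: "finite {F. maximal_intersecting n k F}"
  by (rule finite_subset[of _ "Pow (nsets {1..n} k)"])
    (auto simp: maximal_intersecting_def finite_imp_finite_nsets)

lemma intersecting_extends_to_maximal:
  assumes "F \<subseteq> nsets {1..n} k" "intersecting F"
  shows "\<exists>F'. maximal_intersecting n k F' \<and> F \<subseteq> F'"
proof -
  let ?\<X> = "{F'. F' \<subseteq> nsets {1..n} k \<and> intersecting F'}"
  have "finite ?\<X>"
    by (rule finite_subset[of _ "Pow (nsets {1..n} k)"]) (auto simp: finite_imp_finite_nsets)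
  moreover have "F \<in> ?\<X>" using assms by simp
  ultimately obtain F' where F': "F' \<in> ?\<X>" "F \<subseteq> F'" and max: "\<forall>G\<in>?\<X>. F' \<subseteq> G \<longrightarrow> F' = G"
    using finite_has_maximal2[of ?\<X> F] by blast
  have "\<not> intersecting (insert A F')" if "A \<in> nsets {1..n} k - F'" for A
  proof
    assume "intersecting (insert A F')"
    with that F' have "insert A F' \<in> ?\<X>" by auto
    with max have "F' = insert A F'" by blast
    with that show False by blast
  qed
  with F' show ?thesis by (auto simp: maximal_intersecting_def)
qed

lemma M_pos: "0 < M n k"
proof -
  obtain F where "maximal_intersecting n k F"
    using intersecting_extends_to_maximal[of "{}" n k] by (auto simp: intersecting_def)
  then show ?thesis
    using finite_maximal_intersecting[of n k] by (auto simp: M_def card_gt_0_iff)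
qed

text \<open>The lower bound comes from the cliques of Erdos and Lovasz: each complementary pair of halves
  of \<open>Y\<close> is tied together by a point outside \<open>Y\<close>, and these points are chosen freely.\<close>

lemma M_lower:
  assumes "0 < k" and Y: "Y \<subseteq> {1..n}" "card Y = 2 * (k - 1)"
    and H: "H \<subseteq> nsets Y (k - 1)"
    and meet: "\<And>E E'. E \<in> H \<Longrightarrow> E' \<in> H \<Longrightarrow> E \<noteq> E' \<Longrightarrow> E \<inter> E' \<noteq> {}"
  shows "(n - 2 * (k - 1)) ^ card H \<le> M n k"
proof -
  define fam where "fam f = (\<Union>E\<in>H. {insert (f E) E, insert (f E) (Y - E)})"
    for f :: "nat set \<Rightarrow> nat"
  let ?P = "H \<rightarrow>\<^sub>E ({1..n} - Y)"
  have "finite Y" using Y finite_subset by blast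
  then have "finite H" using H finite_imp_finite_nsets finite_subset by blast
  have HD: "E \<subseteq> Y" "finite E" "card E = k - 1" "card (Y - E) = k - 1" if "E \<in> H" for E
  proof -
    show E: "E \<subseteq> Y" "finite E" "card E = k - 1" using H that by (auto simp: nsets_def)
    show "card (Y - E) = k - 1" using E Y by (simp add: card_Diff_subset)
  qed
  \<comment> \<open>Distinct sets of equal size are incomparable, so each meets the complement of
    the other. Two complements meet because halves with a common point cannot cover
    \<open>Y\<close>.\<close>
  have meet_compl: "E \<inter> (Y - E') \<noteq> {}" "(Y - E) \<inter> E' \<noteq> {}" "(Y - E) \<inter> (Y - E') \<noteq> {}"
    if E: "E \<in> H" "E' \<in> H" "E \<noteq> E'" for E E'
  proof -
    have "\<not> E \<subseteq> E'" "\<not> E' \<subseteq> E" using E HD card_subset_eq by metis+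
    then show "E \<inter> (Y - E') \<noteq> {}" "(Y - E) \<inter> E' \<noteq> {}" using HD(1) E by blast+
    show "(Y - E) \<inter> (Y - E') \<noteq> {}"
    proof
      assume "(Y - E) \<inter> (Y - E') = {}"
      then have "Y = E \<union> E'" using HD(1) E by blast
      then have "card (E \<inter> E') = 0"
        using card_Un_Int[of E E'] HD E Y(2) by simp
      then show False using meet[OF E] HD(2) E by simp
    qed
  qed
  have fam: "fam f \<subseteq> nsets {1..n} k \<and> intersecting (fam f)" if "f \<in> ?P" for f
  proof
    have f: "f E \<in> {1..n} - Y" if "E \<in> H" for E using \<open>f \<in> ?P\<close> that by blast
    show "fam f \<subseteq> nsets {1..n} k"
    proof
      fix G assume "G \<in> fam f"
      then obtain E where E: "E \<in> H" "G = insert (f E) E \<or> G = insert (f E) (Y - E)"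
        by (auto simp: fam_def)
      have "f E \<notin> E" using f[OF E(1)] HD(1)[OF E(1)] by blast
      with E f[OF E(1)] HD[OF E(1)] Y(1) \<open>0 < k\<close> \<open>finite Y\<close> show "G \<in> nsets {1..n} k"
        by (auto simp: nsets_def card_insert_if)
    qed
    show "intersecting (fam f)"
      unfolding intersecting_def
    proof (intro ballI)
      fix G G' assume "G \<in> fam f" "G' \<in> fam f"
      then obtain E E' where "E \<in> H" "G = insert (f E) E \<or> G = insert (f E) (Y - E)"
        and "E' \<in> H" "G' = insert (f E') E' \<or> G' = insert (f E') (Y - E')"
        unfolding fam_def by blast
      then show "G \<inter> G' \<noteq> {}"
        using meet[of E E'] meet_compl[of E E'] by (cases "E = E'") blast+
    qed
  qed
  have "\<exists>F. maximal_intersecting n k F \<and> fam f \<subseteq> F" if "f \<in> ?P" for f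
    using fam[OF that] by (intro intersecting_extends_to_maximal) auto
  then obtain ext where ext: "\<And>f. f \<in> ?P \<Longrightarrow> maximal_intersecting n k (ext f) \<and> fam f \<subseteq> ext f"
    by metis
  \<comment> \<open>Where \<open>f\<close> and \<open>g\<close> differ at \<open>E\<close>, the set
    \<open>insert (f E) E\<close> is disjoint from \<open>insert (g E) (Y - E)\<close>, so no
    intersecting family extends both.\<close>
  have "inj_on ext ?P"
  proof (rule inj_onI, rule ccontr)
    fix f g assume fg: "f \<in> ?P" "g \<in> ?P" "ext f = ext g" "f \<noteq> g"
    then obtain E where E: "E \<in> H" "f E \<noteq> g E" by (meson PiE_ext)
    have "insert (f E) E \<in> ext f" "insert (g E) (Y - E) \<in> ext f"
      using ext[OF fg(1)] ext[OF fg(2)] fg(3) E(1) by (auto simp: fam_def)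
    then have "insert (f E) E \<inter> insert (g E) (Y - E) \<noteq> {}"
      using ext[OF fg(1)] by (auto simp: maximal_intersecting_def intersecting_def)
    moreover have "f E \<notin> Y" "g E \<notin> Y" using fg(1,2) E(1) by blast+
    ultimately show False using E HD(1)[OF E(1)] by blast
  qed
  then have "card ?P \<le> M n k"
    unfolding M_def using ext finite_maximal_intersecting
    by (intro card_inj_on_le[of ext]) auto
  moreover have "card ?P = (n - 2 * (k - 1)) ^ card H"
    using \<open>finite H\<close> \<open>finite Y\<close> Y by (simp add: card_PiE card_Diff_subset)
  ultimately show ?thesis by simp
qed

text \<open>For \<open>k\<close> at least \<open>2\<close>, take all halves through the point
  \<open>1\<close>. The strict inequality leaves room to pass from powers of
  \<open>n - 2 * (k - 1)\<close> to powers of \<open>n\<close>.\<close>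

lemma intersecting_half_sets:
  assumes "0 < k"
  obtains H where "H \<subseteq> nsets {1..2 * (k - 1)} (k - 1)"
    and "\<And>E E'. E \<in> H \<Longrightarrow> E' \<in> H \<Longrightarrow> E \<noteq> E' \<Longrightarrow> E \<inter> E' \<noteq> {}"
    and "(2 * k) choose k < 8 * card H"
proof (cases "k = 1")
  case True
  show ?thesis by (rule that[of "{{}}"]) (auto simp: True)
next
  case False
  define j where "j = k - 2"
  have k: "k = j + 2" using assms False by (simp add: j_def)
  define H where "H = insert 1 ` nsets {2..2 * (k - 1)} j"
  have "inj_on (insert 1) (nsets {2..2 * (k - 1)} j)"
  proof (rule inj_onI)
    fix E E' assume "E \<in> nsets {2..2 * (k - 1)} j" "E' \<in> nsets {2..2 * (k - 1)} j"
    then have "1 \<notin> E" "1 \<notin> E'" by (auto simp: nsets_def)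
    moreover assume "insert 1 E = insert 1 E'"
    ultimately show "E = E'" by (simp add: insert_ident)
  qed
  then have "card H = (2 * j + 1) choose j"
    by (simp add: H_def card_image k)
  \<comment> \<open>Three applications of Pascal's rule each contribute a factor of at most
    \<open>2\<close>, the middle one strictly less.\<close>
  moreover have "(2 * j + 4) choose (j + 2) < 8 * ((2 * j + 1) choose j)"
  proof -
    have "(2 * j + 4) choose (j + 2) = ((2 * j + 3) choose (j + 1)) + ((2 * j + 3) choose (j + 2))"
      by (simp add: numeral_eq_Suc)
    also have "(2 * j + 3) choose (j + 2) = (2 * j + 3) choose (j + 1)"
      by (subst binomial_symmetric) auto
    also have "(2 * j + 3) choose (j + 1) = ((2 * j + 2) choose j) + ((2 * j + 2) choose (j + 1))"
      by (simp add: numeral_eq_Suc)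
    also have "(2 * j + 2) choose j < (2 * j + 2) choose (j + 1)"
      by (rule binomial_strict_mono) auto
    also have "(2 * j + 2) choose (j + 1) = ((2 * j + 1) choose j) + ((2 * j + 1) choose (j + 1))"
      by simp
    also have "(2 * j + 1) choose (j + 1) = (2 * j + 1) choose j"
      by (subst binomial_symmetric) auto
    finally show ?thesis by simp
  qed
  moreover have "2 * k = 2 * j + 4" by (simp add: k)
  ultimately have card_H: "(2 * k) choose k < 8 * card H" by (metis k)
  have H_sub: "H \<subseteq> nsets {1..2 * (k - 1)} (k - 1)"
    by (auto simp: H_def nsets_def k card_insert_if)
  have "E \<inter> E' \<noteq> {}" if "E \<in> H" "E' \<in> H" for E E'
    using that by (auto simp: H_def)
  with H_sub card_H show ?thesis by (intro that[of H]) simp_all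
qed

section \<open>Asymptotics for fixed \<open>k\<close>\<close>

lemma eventually_M_le_powr:
  assumes "0 < k"
  shows "\<forall>\<^sub>F n in sequentially. real (M n k) \<le> real n powr (2 * real ((2 * k) choose k))"
proof -
  define D where "D = (2 * k) choose k"
  have "1 \<le> D" by (simp add: D_def Suc_leI)
  have "real (M n k) \<le> real n powr (2 * real D)" if n: "n \<ge> max (2 * k) (2 ^ 2 ^ D)" for n
  proof -
    have "0 < n" using n assms by simp
    have "M n k \<le> n ^ D * 2 ^ 2 ^ D" unfolding D_def using n assms by (intro M_upper) auto
    \<comment> \<open>For \<open>n\<close> this large the constant factor is at most
      \<open>n\<close>, hence at most \<open>n ^ D\<close>; this is where the \<open>2\<close> in
      the exponent comes from.\<close>
    also have "\<dots> \<le> n ^ D * n ^ D"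
      using n \<open>0 < n\<close> power_increasing[OF \<open>1 \<le> D\<close>, of n] by (intro mult_le_mono2) simp
    finally have "real (M n k) \<le> real (n ^ D * n ^ D)" by (rule of_nat_mono)
    also have "n ^ D * n ^ D = n ^ (2 * D)" by (simp only: mult_2 power_add)
    also have "real (n ^ (2 * D)) = real n powr real (2 * D)"
      using \<open>0 < n\<close> by (simp only: powr_realpow of_nat_power of_nat_0_less_iff)
    also have "real (2 * D) = 2 * real D" by simp
    finally show ?thesis .
  qed
  then show ?thesis unfolding D_def eventually_sequentially by blast
qed

lemma eventually_powr_le_M:
  assumes "0 < k"
  shows "\<forall>\<^sub>F n in sequentially. real n powr (1 / 8 * real ((2 * k) choose k)) \<le> real (M n k)"
proof -
  define c where "c = 2 * (k - 1)"
  define D where "D = real ((2 * k) choose k)"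
  obtain H where H: "H \<subseteq> nsets {1..c} (k - 1)"
    "\<And>E E'. E \<in> H \<Longrightarrow> E' \<in> H \<Longrightarrow> E \<noteq> E' \<Longrightarrow> E \<inter> E' \<noteq> {}"
    and "(2 * k) choose k < 8 * card H"
    unfolding c_def using intersecting_half_sets[OF assms] by metis
  define N where "N = card H"
  have "0 < real N - D / 8"
    using \<open>(2 * k) choose k < 8 * card H\<close> by (simp add: D_def N_def)
  have "filterlim (\<lambda>n. ln (real n)) at_top sequentially"
    by (rule filterlim_compose[OF ln_at_top filterlim_real_sequentially])
  \<comment> \<open>Rearranged, this says that \<open>(n / 2) ^ N\<close> is at least
    \<open>n powr (D / 8)\<close>.\<close>
  then have "\<forall>\<^sub>F n in sequentially. real N * ln 2 / (real N - D / 8) \<le> ln (real n)"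
    by (simp add: filterlim_at_top)
  \<comment> \<open>This makes \<open>n - c\<close> at least \<open>n / 2\<close>.\<close>
  moreover have "\<forall>\<^sub>F n in sequentially. 2 * c + 1 \<le> n" by (rule eventually_ge_at_top)
  ultimately show ?thesis
  proof eventually_elim
    case (elim n)
    have "0 < n" using elim by simp
    have "D / 8 * ln n \<le> real N * (ln n - ln 2)"
      using elim(1) \<open>0 < real N - D / 8\<close> by (simp add: field_simps)
    then have "exp (D / 8 * ln n) \<le> exp (real N * ln (real n / 2))"
      using \<open>0 < n\<close> by (simp add: ln_div)
    then have "real n powr (1 / 8 * D) \<le> (real n / 2) ^ N"
      using \<open>0 < n\<close> by (simp add: powr_def flip: powr_realpow)
    also have "\<dots> \<le> real (n - c) ^ N"
      using elim(2) by (intro power_mono) auto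
    also have "\<dots> \<le> real (M n k)"
      unfolding N_def of_nat_power[symmetric] of_nat_le_iff c_def
      using H elim(2) assms by (intro M_lower) (auto simp: c_def)
    finally show ?case by (simp add: D_def)
  qed
qed

lemma limsup_log_ratio_ge:
  assumes "0 < k"
  shows "ereal (1 / 8) \<le> limsup (\<lambda>n. log_ratio n k)"
proof (rule le_Limsup)
  show "\<forall>\<^sub>F n in sequentially. ereal (1 / 8) \<le> log_ratio n k"
    using eventually_powr_le_M[OF assms] eventually_gt_at_top[of 1]
  proof eventually_elim
    case (elim n)
    have "ln (real n powr (1 / 8 * real ((2 * k) choose k))) \<le> ln (real (M n k))"
      using elim M_pos[of n k] by (subst ln_le_cancel_iff) auto
    then have "1 / 8 * real ((2 * k) choose k) * ln n \<le> ln (real (M n k))"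
      using elim(2) by simp
    moreover have "0 < real ((2 * k) choose k) * ln n" using elim(2) by simp
    ultimately show ?case by (simp add: log_ratio_def field_simps)
  qed
qed simp

lemma limsup_log_ratio_le:
  assumes "0 < k"
  shows "limsup (\<lambda>n. log_ratio n k) \<le> 1"
proof -
  define D where "D = (2 * k) choose k"
  \<comment> \<open>\<open>K / ln n\<close> is the share of the constant factor
    \<open>2 ^ 2 ^ D\<close> in the ratio, and it tends to \<open>0\<close>.\<close>
  define K where "K = 2 ^ D * ln 2 / real D"
  have "0 < D" by (simp add: D_def)
  have "\<forall>\<^sub>F n in sequentially. log_ratio n k \<le> ereal (1 + K / ln (real n))"
    using eventually_ge_at_top[of "max 2 (2 * k)"]
  proof eventually_elim
    case (elim n)
    then have n: "1 < n" "2 * k \<le> n" by auto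
    have "M n k \<le> n ^ D * 2 ^ 2 ^ D" unfolding D_def using n assms by (intro M_upper) auto
    then have "real (M n k) \<le> real (n ^ D * 2 ^ 2 ^ D)" by (rule of_nat_mono)
    then have "real (M n k) \<le> real n ^ D * 2 ^ 2 ^ D" by simp
    then have "ln (real (M n k)) \<le> ln (real n ^ D * 2 ^ 2 ^ D)"
      using M_pos[of n k] by (subst ln_le_cancel_iff) (use n in auto)
    also have "\<dots> = real D * ln n + 2 ^ D * ln 2"
      using n by (simp add: ln_mult ln_realpow)
    finally have "ln (real (M n k)) / (real D * ln n) \<le> (real D * ln n + 2 ^ D * ln 2) / (real D * ln n)"
      using n by (intro divide_right_mono) auto
    also have "\<dots> = 1 + K / ln n"
      using n \<open>0 < D\<close> by (simp add: K_def field_simps)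
    finally show ?case by (simp add: log_ratio_def D_def)
  qed
  then have "limsup (\<lambda>n. log_ratio n k) \<le> limsup (\<lambda>n. ereal (1 + K / ln (real n)))"
    by (rule Limsup_mono)
  also have "\<dots> = ereal (1 + 0)"
  proof (rule lim_imp_Limsup)
    have "filterlim (\<lambda>n. ln (real n)) at_top sequentially"
      by (rule filterlim_compose[OF ln_at_top filterlim_real_sequentially])
    then have "(\<lambda>n. K / ln (real n)) \<longlonglongrightarrow> 0"
      by (intro tendsto_divide_0[OF tendsto_const] filterlim_at_top_imp_at_infinity)
    then show "(\<lambda>n. ereal (1 + K / ln (real n))) \<longlonglongrightarrow> ereal (1 + 0)"
      by (intro tendsto_intros)
  qed simp
  finally show ?thesis by (simp add: one_ereal_def)
qed

theorem theorem1p4: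
  shows "(\<exists>c C :: real. 0 < c \<and> 0 < C \<and>
            (\<forall>k::nat. k > 0 \<longrightarrow>
              (\<forall>\<^sub>F n in sequentially.
                 real n powr (c * real ((2 * k) choose k)) \<le> real (M n k) \<and>
                 real (M n k) \<le> real n powr (C * real ((2 * k) choose k)))))
       \<and> (\<forall>k::nat. k > 0 \<longrightarrow>
              ereal (1 / 8) \<le> limsup (\<lambda>n. log_ratio n k) \<and>
              limsup (\<lambda>n. log_ratio n k) \<le> ereal (11 / 10))
       \<and> limsup (\<lambda>k. limsup (\<lambda>n. log_ratio n k)) \<le> 1"
proof (intro conjI)
  show "\<exists>c C :: real. 0 < c \<and> 0 < C \<and>
            (\<forall>k::nat. k > 0 \<longrightarrow>
              (\<forall>\<^sub>F n in sequentially.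
                 real n powr (c * real ((2 * k) choose k)) \<le> real (M n k) \<and>
                 real (M n k) \<le> real n powr (C * real ((2 * k) choose k))))"
    by (rule exI[of _ "1 / 8"], rule exI[of _ 2])
      (intro conjI allI impI eventually_conj eventually_powr_le_M eventually_M_le_powr; simp)
  show "\<forall>k::nat. k > 0 \<longrightarrow>
      ereal (1 / 8) \<le> limsup (\<lambda>n. log_ratio n k) \<and> limsup (\<lambda>n. log_ratio n k) \<le> ereal (11 / 10)"
  proof (intro allI impI conjI)
    fix k :: nat assume "k > 0"
    show "ereal (1 / 8) \<le> limsup (\<lambda>n. log_ratio n k)" by (rule limsup_log_ratio_ge) fact
    \<comment> \<open>The bound \<open>1\<close> holds for every positive \<open>k\<close>, so it
      gives both the constant \<open>11 / 10\<close> and the outer limit superior.\<close>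
    have "(1 :: ereal) \<le> ereal (11 / 10)" by (simp add: one_ereal_def)
    with limsup_log_ratio_le[OF \<open>k > 0\<close>] show "limsup (\<lambda>n. log_ratio n k) \<le> ereal (11 / 10)"
      by (rule order.trans)
  qed
  have "\<forall>\<^sub>F k in sequentially. limsup (\<lambda>n. log_ratio n k) \<le> 1"
    using eventually_gt_at_top[of 0] by eventually_elim (rule limsup_log_ratio_le)
  then show "limsup (\<lambda>k. limsup (\<lambda>n. log_ratio n k)) \<le> 1"
    by (rule Limsup_bounded)
qed

end
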